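(* Let $G$ be a simple positively LLY-curved $C_4$-free graph with minimum degree $\delta(G)\geq 2$. Then the maximum degree satisfies $\Delta(G)\leq 6$, and this upper bound is sharp, i.e. there exists a simple positively LLY-curved $C_4$-free graph $G$ with $\delta(G)\ge 2$ and $\Delta(G)=6$.
   Context: Graphs are undirected and simple, and every vertex has finite degree. For a graph $G=(V,E)$, $d_v$ is the degree of $v$, $N(v)$ its neighborhood, $N[v]=N(v)\cup\{v\}$, $d(u,v)$ the graph distance (number of edges in a shortest path), $\delta(G)$ and $\Delta(G)$ the minimum and maximum degree. $G$ is $F$-free if it contains no copy of $F$ as a (not necessarily induced) subgraph; $C_n$ is the cycle on $n$ vertices. Lin-Lu-Yau (LLY) curvature: for a vertex $x$ and $0\le\alpha<1$, let $m_x^\alpha$ be the probability distribution on $V$ with $m_x^\alpha(x)=\alpha$, $m_x^\alpha(v)=(1-\alpha)/d_x$ for $v\in N(x)$, and $m_x^\alpha(v)=0$ otherwise. For finitely supported probability distributions $m_1,m_2$ on $V$, a coupling is a finitely supported map $A:V\times V\to[0,1]$ with $\sum_{y}A(x,y)=m_1(x)$ and $\sum_x A(x,y)=m_2(y)$, and $W(m_1,m_2)=\inf_A\sum_{x,y\in V}A(x,y)d(x,y)$ over all couplings $A$ (with the convention $0\cdot\infty=0$). For $x\ne y$ put $\kappa_\alpha(x,y)=1-\frac{W(m_x^\alpha,m_y^\alpha)}{d(x,y)}$ and $\kappa_{\mathrm{LLY}}(x,y)=\lim_{\alpha\to1}\frac{\kappa_\alpha(x,y)}{1-\alpha}$ (the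 limit as $\alpha\to 1^-$, which exists). $G$ is positively LLY-curved if $\kappa_{\mathrm{LLY}}(x,y)>0$ for every edge $xy\in E$ (for connected graphs this is equivalent to positivity for every pair of distinct vertices). *)

theory Defs
  imports Complex_Main "HOL-Library.Extended_Real"
begin

section \<open>Graphs\<close>

record 'a ugraph =
  verts :: "'a set"
  edges :: "'a set set"

definition simple_graph :: "'a ugraph \<Rightarrow> bool" where
  "simple_graph G \<longleftrightarrow> (\<forall>e\<in>edges G. e \<subseteq> verts G \<and> card e = 2)"

definition neighborhood :: "'a ugraph \<Rightarrow> 'a \<Rightarrow> 'a set" where
  "neighborhood G v = {u. {u, v} \<in> edges G}"

definition locally_finite :: "'a ugraph \<Rightarrow> bool" where
  "locally_finite G \<longleftrightarrow> (\<forall>v\<in>verts G. finite (neighborhood G v))"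

definition degree :: "'a ugraph \<Rightarrow> 'a \<Rightarrow> nat" where
  "degree G v = card (neighborhood G v)"

text \<open>Graphs may be infinite, so the degrees need not be bounded a priori; hence
  the extended naturals.\<close>

definition min_degree :: "'a ugraph \<Rightarrow> enat" where
  "min_degree G = (INF v\<in>verts G. enat (degree G v))"

definition max_degree :: "'a ugraph \<Rightarrow> enat" where
  "max_degree G = (SUP v\<in>verts G. enat (degree G v))"

definition path_between :: "'a ugraph \<Rightarrow> 'a \<Rightarrow> 'a \<Rightarrow> 'a list \<Rightarrow> bool" where
  "path_between G u v p \<longleftrightarrow>
     p \<noteq> [] \<and> hd p = u \<and> last p = v \<and> set p \<subseteq> verts G \<and> distinct p \<and>
     successively (\<lambda>a b. {a, b} \<in> edges G) p"

text \<open>The list of vertices of a path with \<open>n\<close> edges has length \<open>n + 1\<close>. Vertices in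
  different components are at distance \<open>Inf {} = \<infinity>\<close>.\<close>

definition graph_dist :: "'a ugraph \<Rightarrow> 'a \<Rightarrow> 'a \<Rightarrow> enat" where
  "graph_dist G u v = Inf {enat (length p - 1) | p. path_between G u v p}"

definition contains_copy :: "'a ugraph \<Rightarrow> 'b ugraph \<Rightarrow> bool" where
  "contains_copy G F \<longleftrightarrow>
     (\<exists>f. inj_on f (verts F) \<and> f ` verts F \<subseteq> verts G \<and> (\<forall>e\<in>edges F. f ` e \<in> edges G))"

definition graph_free :: "'b ugraph \<Rightarrow> 'a ugraph \<Rightarrow> bool" where
  "graph_free F G \<longleftrightarrow> \<not> contains_copy G F"

text \<open>Intended for \<open>n \<ge> 3\<close>.\<close>

definition cycle_graph :: "nat \<Rightarrow> nat ugraph" where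
  "cycle_graph n = \<lparr>verts = {..<n}, edges = {{i, Suc i mod n} | i. i < n}\<rparr>"

section \<open>Lin--Lu--Yau curvature\<close>

definition lazy_dist :: "'a ugraph \<Rightarrow> real \<Rightarrow> 'a \<Rightarrow> 'a \<Rightarrow> real" where
  "lazy_dist G \<alpha> x v =
     (if v = x then \<alpha>
      else if v \<in> neighborhood G x then (1 - \<alpha>) / real (degree G x)
      else 0)"

text \<open>Couplings are maps on pairs of vertices, extended by 0 to all pairs over the type.
  They have finite support, so the sums over all vertices are sums over the support.\<close>

definition coupling ::
  "'a ugraph \<Rightarrow> ('a \<Rightarrow> real) \<Rightarrow> ('a \<Rightarrow> real) \<Rightarrow> ('a \<times> 'a \<Rightarrow> real) \<Rightarrow> bool" where
  "coupling G m1 m2 A \<longleftrightarrow>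
     finite {p. A p \<noteq> 0} \<and> {p. A p \<noteq> 0} \<subseteq> verts G \<times> verts G \<and>
     (\<forall>p. 0 \<le> A p \<and> A p \<le> 1) \<and>
     (\<forall>x\<in>verts G. (\<Sum>y | A (x, y) \<noteq> 0. A (x, y)) = m1 x) \<and>
     (\<forall>y\<in>verts G. (\<Sum>x | A (x, y) \<noteq> 0. A (x, y)) = m2 y)"

definition transport_cost :: "'a ugraph \<Rightarrow> ('a \<times> 'a \<Rightarrow> real) \<Rightarrow> ereal" where
  "transport_cost G A =
     (\<Sum>(x, y) | A (x, y) \<noteq> 0. ereal (A (x, y)) * ereal_of_enat (graph_dist G x y))"

definition wasserstein :: "'a ugraph \<Rightarrow> ('a \<Rightarrow> real) \<Rightarrow> ('a \<Rightarrow> real) \<Rightarrow> ereal" where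
  "wasserstein G m1 m2 = Inf {transport_cost G A | A. coupling G m1 m2 A}"

text \<open>The following two are meaningful for distinct vertices at finite distance;
  there all the quantities involved are finite.\<close>

definition kappa :: "'a ugraph \<Rightarrow> real \<Rightarrow> 'a \<Rightarrow> 'a \<Rightarrow> ereal" where
  "kappa G \<alpha> x y =
     1 - wasserstein G (lazy_dist G \<alpha> x) (lazy_dist G \<alpha> y) / ereal_of_enat (graph_dist G x y)"

definition lly_curvature :: "'a ugraph \<Rightarrow> 'a \<Rightarrow> 'a \<Rightarrow> ereal" where
  "lly_curvature G x y = Lim (at_left 1) (\<lambda>\<alpha>. kappa G \<alpha> x y / ereal (1 - \<alpha>))"

definition positively_lly_curved :: "'a ugraph \<Rightarrow> bool" where
  "positively_lly_curved G \<longleftrightarrow> (\<forall>x y. {x, y} \<in> edges G \<longrightarrow> 0 < lly_curvature G x y)"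

end

theory Submission imports Defs
begin

text \<open>
  The quotients \<open>\<kappa>\<^sub>\<alpha> / (1 - \<alpha>)\<close> increase with \<open>\<alpha>\<close>, since a coupling for \<open>\<alpha>\<close> can be mixed with the
  point mass at \<open>(x, y)\<close>; hence the curvature is their supremum. Testing the transport against a
  1-Lipschitz function gives, on an edge \<open>xy\<close> of a graph without 4-cycles,
  \<open>\<kappa> \<le> 1/d\<^sub>x + (2 + 2c)/d\<^sub>y - 1\<close>, where \<open>c \<le> 1\<close> is the number of common neighbours. If \<open>\<kappa> > 0\<close> and
  \<open>d\<^sub>x \<ge> 2\<close>, then \<open>d\<^sub>y \<le> 7\<close>, and \<open>d\<^sub>y = 7\<close> forces \<open>c = 1\<close>. So if \<open>d\<^sub>y = 7\<close>, every edge at \<open>y\<close> lies in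
  exactly one triangle, and the triangles match up the seven neighbours of \<open>y\<close> in pairs, which is
  absurd. Three triangles glued at a vertex attain degree 6.
\<close>

section \<open>Edges, neighbourhoods and 4-cycles in elementary form\<close>

lemma simple_graphD:
  assumes "simple_graph G" "{u, v} \<in> edges G"
  shows "u \<noteq> v" "u \<in> verts G" "v \<in> verts G"
  using assms by (force simp: simple_graph_def)+

lemma neighborhood_iff: "u \<in> neighborhood G v \<longleftrightarrow> {v, u} \<in> edges G"
  by (simp add: neighborhood_def insert_commute)

lemma not_self_neighbor: "simple_graph G \<Longrightarrow> v \<notin> neighborhood G v"
  using simple_graphD(1)[of G v v] by (auto simp: neighborhood_iff)

lemma contains_copy_cycle_4_iff:
  assumes "simple_graph G"
  shows "contains_copy G (cycle_graph 4) \<longleftrightarrow>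
    (\<exists>a b c d. distinct [a, b, c, d] \<and>
      {a, b} \<in> edges G \<and> {b, c} \<in> edges G \<and> {c, d} \<in> edges G \<and> {d, a} \<in> edges G)"
    (is "_ \<longleftrightarrow> ?R")
proof -
  have 4: "{..<4} = {0, 1, 2, 3 :: nat}" by auto
  then have V: "verts (cycle_graph 4) = {0, 1, 2, 3}"
    by (simp add: cycle_graph_def)
  have "edges (cycle_graph 4) = (\<lambda>i. {i, (i + 1) mod 4}) ` {..<4}"
    by (simp add: cycle_graph_def image_def Bex_def conj_commute)
  \<comment> \<open>\<open>Suc i mod n\<close> parses as \<open>(Suc i) mod n\<close>, so the index
    3 yields the closing edge \<open>{3, 0}\<close>.\<close>
  then have E: "edges (cycle_graph 4) = {{0, 1}, {1, 2}, {2, 3}, {3, 0}}"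
    unfolding 4 by (simp flip: numeral_2_eq_2)
  show ?thesis
  proof
    assume "contains_copy G (cycle_graph 4)"
    then obtain f where "inj_on f {0, 1, 2, 3 :: nat}"
      "{f 0, f 1} \<in> edges G" "{f 1, f 2} \<in> edges G" "{f 2, f 3} \<in> edges G" "{f 3, f 0} \<in> edges G"
      unfolding contains_copy_def V E by auto
    then show ?R
      by (intro exI[of _ "f 0"] exI[of _ "f 1"] exI[of _ "f 2"] exI[of _ "f 3"]) (auto simp: inj_on_def)
  next
    assume ?R
    then obtain a b c d where *: "distinct [a, b, c, d]" "{a, b} \<in> edges G" "{b, c} \<in> edges G"
      "{c, d} \<in> edges G" "{d, a} \<in> edges G" by blast
    define f where "f i = [a, b, c, d] ! i" for i
    have f: "f 0 = a" "f 1 = b" "f 2 = c" "f 3 = d"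
      by (simp_all add: f_def)
    have "inj_on f {0, 1, 2, 3}" using *(1) f by (auto simp: inj_on_def)
    moreover have "f ` {0, 1, 2, 3} \<subseteq> verts G" using simple_graphD[OF assms] * f by auto
    moreover have "\<forall>e\<in>{{0, 1}, {1, 2}, {2, 3}, {3, 0}}. f ` e \<in> edges G" using * f by simp
    ultimately show "contains_copy G (cycle_graph 4)"
      unfolding contains_copy_def V E by blast
  qed
qed

section \<open>Distances and couplings\<close>

lemma graph_dist_le:
  "path_between G u v p \<Longrightarrow> graph_dist G u v \<le> enat (length p - 1)"
  unfolding graph_dist_def by (rule Inf_lower) auto

lemma graph_dist_refl: "v \<in> verts G \<Longrightarrow> graph_dist G v v = 0"
  using graph_dist_le[of G v v "[v]"] by (simp add: path_between_def flip: zero_enat_def)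

lemma graph_dist_edge_le:
  assumes "simple_graph G" "{u, v} \<in> edges G"
  shows "graph_dist G u v \<le> 1"
  using graph_dist_le[of G u v "[u, v]"] simple_graphD[OF assms] assms
  by (simp add: path_between_def one_enat_def)

lemma graph_dist_common_neighbor_le:
  assumes "simple_graph G" "{u, w} \<in> edges G" "{w, v} \<in> edges G" "u \<noteq> v"
  shows "graph_dist G u v \<le> 2"
  using graph_dist_le[of G u v "[u, w, v]"] simple_graphD[OF assms(1,2)]
    simple_graphD[OF assms(1,3)] assms
  by (simp add: path_between_def numeral_eq_enat eval_nat_numeral)

lemma graph_dist_ge_1:
  assumes "u \<noteq> v"
  shows "1 \<le> graph_dist G u v"
  unfolding graph_dist_def
proof (rule Inf_greatest, clarify)
  fix p assume "path_between G u v p"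
  then show "1 \<le> enat (length p - 1)"
    using assms by (cases p; cases "tl p") (auto simp: path_between_def one_enat_def)
qed

lemma graph_dist_ge_2:
  assumes "u \<noteq> v" "{u, v} \<notin> edges G"
  shows "2 \<le> graph_dist G u v"
  unfolding graph_dist_def
proof (rule Inf_greatest, clarify)
  \<comment> \<open>A path with one vertex would force \<open>u = v\<close>, one with two vertices
    would be the excluded edge; hence the three nested case splits.\<close>
  fix p assume "path_between G u v p"
  then show "2 \<le> enat (length p - 1)"
    using assms
    by (cases p; cases "tl p"; cases "tl (tl p)") (auto simp: path_between_def numeral_eq_enat)
qed

lemma graph_dist_edge:
  "simple_graph G \<Longrightarrow> {u, v} \<in> edges G \<Longrightarrow> graph_dist G u v = 1"
  by (intro antisym graph_dist_edge_le graph_dist_ge_1) (auto dest: simple_graphD)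

section \<open>Couplings over a fixed finite rectangle, and the dual lower bound for their
  cost\<close>

lemma sum_row_eq:
  assumes "finite T" "{p. A p \<noteq> 0} \<subseteq> S \<times> T"
  shows "(\<Sum>y | A (x, y) \<noteq> 0. A (x, y)) = (\<Sum>y\<in>T. A (x, y))"
  using assms by (intro sum.mono_neutral_left) auto

lemma sum_column_eq:
  assumes "finite S" "{p. A p \<noteq> 0} \<subseteq> S \<times> T"
  shows "(\<Sum>x | A (x, y) \<noteq> 0. A (x, y)) = (\<Sum>x\<in>S. A (x, y))"
  using assms by (intro sum.mono_neutral_left) auto

text \<open>Enlarging the support is harmless even for pairs in different components, because zero
  times infinity is zero in \<open>ereal\<close>. A fixed index set is what makes sums comparable
  and exchangeable.\<close>

lemma transport_cost_eq:
  assumes "finite R" "{p. A p \<noteq> 0} \<subseteq> R"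
  shows "transport_cost G A = (\<Sum>(x, y)\<in>R. ereal (A (x, y)) * ereal_of_enat (graph_dist G x y))"
proof -
  have "{(x, y). A (x, y) \<noteq> 0} = {p. A p \<noteq> 0}" by auto
  with assms show ?thesis
    unfolding transport_cost_def by (intro sum.mono_neutral_left) (auto simp flip: zero_ereal_def)
qed

lemma couplingI:
  assumes "finite S" "finite T" "S \<subseteq> verts G" "T \<subseteq> verts G" "{p. A p \<noteq> 0} \<subseteq> S \<times> T"
    and "\<And>p. 0 \<le> A p" "\<And>p. A p \<le> 1"
    and "\<And>x. x \<in> verts G \<Longrightarrow> (\<Sum>y\<in>T. A (x, y)) = m1 x"
    and "\<And>y. y \<in> verts G \<Longrightarrow> (\<Sum>x\<in>S. A (x, y)) = m2 y"
  shows "coupling G m1 m2 A"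
  unfolding coupling_def sum_row_eq[OF assms(2,5)] sum_column_eq[OF assms(1,5)]
  using assms finite_subset[OF assms(5)] by auto

lemma couplingD:
  assumes "coupling G m1 m2 A"
  shows "finite {p. A p \<noteq> 0}" "{p. A p \<noteq> 0} \<subseteq> verts G \<times> verts G"
    and "\<And>p. 0 \<le> A p" "\<And>p. A p \<le> 1"
    and "\<And>x. x \<in> verts G \<Longrightarrow> (\<Sum>y | A (x, y) \<noteq> 0. A (x, y)) = m1 x"
    and "\<And>y. y \<in> verts G \<Longrightarrow> (\<Sum>x | A (x, y) \<noteq> 0. A (x, y)) = m2 y"
  using assms unfolding coupling_def by blast+

lemma coupling_swap:
  assumes "coupling G m1 m2 A"
  shows "coupling G m2 m1 (A \<circ> prod.swap)"
proof -
  have "{p. (A \<circ> prod.swap) p \<noteq> 0} = prod.swap ` {p. A p \<noteq> 0}"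
    unfolding image_def by (auto simp: prod.swap_def split: prod.splits)
  then have "finite {p. (A \<circ> prod.swap) p \<noteq> 0}" "{p. (A \<circ> prod.swap) p \<noteq> 0} \<subseteq> verts G \<times> verts G"
    using couplingD(1,2)[OF assms] by auto
  then show ?thesis
    unfolding coupling_def using couplingD(3-6)[OF assms] by simp
qed

text \<open>The entries are nonnegative, so a nonzero entry cannot cancel in its row or column
  sum.\<close>

lemma coupling_support:
  assumes "coupling G m1 m2 A" "A (x, y) \<noteq> 0"
  shows "x \<in> verts G" "y \<in> verts G" "m1 x \<noteq> 0" "m2 y \<noteq> 0"
proof -
  show xy: "x \<in> verts G" "y \<in> verts G"
    using couplingD(2)[OF assms(1)] assms(2) by auto
  let ?X = "fst ` {p. A p \<noteq> 0}" and ?Y = "snd ` {p. A p \<noteq> 0}"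
  have fin: "finite ?X" "finite ?Y"
    using couplingD(1)[OF assms(1)] by simp_all
  have sub: "{p. A p \<noteq> 0} \<subseteq> ?X \<times> ?Y"
    by (simp add: subset_fst_snd)
  have "m1 x = (\<Sum>y\<in>?Y. A (x, y))" "m2 y = (\<Sum>x\<in>?X. A (x, y))"
    using couplingD(5,6)[OF assms(1)] xy sum_row_eq[OF fin(2) sub] sum_column_eq[OF fin(1) sub]
    by simp_all
  moreover have "x \<in> ?X" "y \<in> ?Y" using assms(2) by force+
  ultimately show "m1 x \<noteq> 0" "m2 y \<noteq> 0"
    using assms(2) couplingD(3)[OF assms(1)] fin by (auto simp: sum_nonneg_eq_0_iff)
qed

text \<open>This is the easy half of Kantorovich duality. The Lipschitz condition is one-sided and
  restricted to \<open>S\<close> and \<open>T\<close>, since a coupling only charges pairs from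
  there.\<close>

lemma transport_cost_ge:
  assumes coupl: "coupling G m1 m2 A"
    and S: "finite S" "S \<subseteq> verts G" "\<And>x. m1 x \<noteq> 0 \<Longrightarrow> x \<in> S"
    and T: "finite T" "T \<subseteq> verts G" "\<And>y. m2 y \<noteq> 0 \<Longrightarrow> y \<in> T"
    and lip: "\<And>x y. x \<in> S \<Longrightarrow> y \<in> T \<Longrightarrow> ereal (f y - f x) \<le> ereal_of_enat (graph_dist G x y)"
  shows "ereal ((\<Sum>y\<in>T. m2 y * f y) - (\<Sum>x\<in>S. m1 x * f x)) \<le> transport_cost G A"
proof -
  have sub: "{p. A p \<noteq> 0} \<subseteq> S \<times> T"
    using coupling_support[OF coupl] S T by auto
  have m1: "(\<Sum>y\<in>T. A (x, y)) = m1 x" if "x \<in> S" for x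
    using couplingD(5)[OF coupl, of x] S(2) that sum_row_eq[OF T(1) sub] by auto
  have m2: "(\<Sum>x\<in>S. A (x, y)) = m2 y" if "y \<in> T" for y
    using couplingD(6)[OF coupl, of y] T(2) that sum_column_eq[OF S(1) sub] by auto
  have "(\<Sum>y\<in>T. m2 y * f y) = (\<Sum>y\<in>T. \<Sum>x\<in>S. A (x, y) * f y)"
    by (simp add: m2 flip: sum_distrib_right)
  also have "\<dots> = (\<Sum>x\<in>S. \<Sum>y\<in>T. A (x, y) * f y)" by (rule sum.swap)
  moreover have "(\<Sum>x\<in>S. m1 x * f x) = (\<Sum>x\<in>S. \<Sum>y\<in>T. A (x, y) * f x)"
    by (simp add: m1 flip: sum_distrib_right)
  \<comment> \<open>Both integrals are now sums of the same plan over \<open>S\<close> and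
    \<open>T\<close>, so their difference charges each transported unit with
    \<open>f y - f x\<close>.\<close>
  ultimately have "(\<Sum>y\<in>T. m2 y * f y) - (\<Sum>x\<in>S. m1 x * f x) = (\<Sum>(x, y)\<in>S\<times>T. A (x, y) * (f y - f x))"
    by (simp add: sum_subtractf right_diff_distrib flip: sum.cartesian_product)
  then have "ereal ((\<Sum>y\<in>T. m2 y * f y) - (\<Sum>x\<in>S. m1 x * f x)) = (\<Sum>p\<in>S\<times>T. ereal (A p * (f (snd p) - f (fst p))))"
    by (simp add: case_prod_beta)
  also have "\<dots> \<le> (\<Sum>(x, y)\<in>S\<times>T. ereal (A (x, y)) * ereal_of_enat (graph_dist G x y))"
    using lip couplingD(3)[OF coupl]
    by (intro sum_mono) (auto simp flip: times_ereal.simps(1) intro!: ereal_mult_left_mono)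
  also have "\<dots> = transport_cost G A"
    using S T sub by (intro transport_cost_eq[symmetric]) auto
  finally show ?thesis .
qed

section \<open>Existence of the curvature\<close>

lemma wasserstein_le: "coupling G m1 m2 A \<Longrightarrow> wasserstein G m1 m2 \<le> transport_cost G A"
  unfolding wasserstein_def by (rule Inf_lower) auto

lemma transport_cost_nonneg: "coupling G m1 m2 A \<Longrightarrow> 0 \<le> transport_cost G A"
  unfolding transport_cost_def
  by (auto simp: ereal_zero_le_0_iff dest: couplingD(3) intro!: sum_nonneg)

lemma wasserstein_nonneg: "0 \<le> wasserstein G m1 m2"
  unfolding wasserstein_def by (rule Inf_greatest) (auto dest: transport_cost_nonneg)

text \<open>The new plan carries out \<open>A\<close> at scale \<open>t\<close> and sends the
  remaining mass \<open>1 - t\<close> straight from \<open>x\<close> to \<open>y\<close>.\<close>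

lemma coupling_mix_point:
  assumes A: "coupling G m1 m2 A" and t: "0 \<le> t" "t \<le> 1"
    and xy: "x \<in> verts G" "y \<in> verts G"
  defines "B \<equiv> \<lambda>p. t * A p + (if p = (x, y) then 1 - t else 0)"
  shows "coupling G (\<lambda>v. t * m1 v + (if v = x then 1 - t else 0))
           (\<lambda>v. t * m2 v + (if v = y then 1 - t else 0)) B"
    and "transport_cost G B =
           ereal t * transport_cost G A + ereal (1 - t) * ereal_of_enat (graph_dist G x y)"
proof -
  let ?S = "insert x (fst ` {p. A p \<noteq> 0})" and ?T = "insert y (snd ` {p. A p \<noteq> 0})"
  have fin: "finite ?S" "finite ?T"
    using couplingD(1)[OF A] by simp_all
  have S: "?S \<subseteq> verts G" and T: "?T \<subseteq> verts G"
    using couplingD(2)[OF A] xy by auto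
  have subA: "{p. A p \<noteq> 0} \<subseteq> ?S \<times> ?T"
    using subset_fst_snd[of "{p. A p \<noteq> 0}"] by blast
  then have subB: "{p. B p \<noteq> 0} \<subseteq> ?S \<times> ?T"
    unfolding B_def by (auto split: if_splits)
  have nonneg: "0 \<le> A p" for p by (rule couplingD(3)[OF A])
  show "coupling G (\<lambda>v. t * m1 v + (if v = x then 1 - t else 0))
           (\<lambda>v. t * m2 v + (if v = y then 1 - t else 0)) B"
  proof (rule couplingI[OF fin S T subB])
    fix p show "0 \<le> B p"
      using nonneg[of p] t by (simp add: B_def)
    show "B p \<le> 1"
    proof -
      have "t * A p \<le> t" using couplingD(4)[OF A, of p] t by (simp add: mult_left_le)
      then show ?thesis using t by (auto simp: B_def)
    qed
  next
    fix u assume "u \<in> verts G"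
    then have "(\<Sum>v\<in>?T. A (u, v)) = m1 u"
      using couplingD(5)[OF A] sum_row_eq[OF fin(2) subA] by metis
    moreover have "(\<Sum>v\<in>?T. if (u, v) = (x, y) then 1 - t else 0) = (if u = x then 1 - t else 0)"
      using fin(2) by (cases "u = x") (simp_all only: prod.inject simp_thms sum.delta if_True if_False insertI1 sum.neutral_const)
    ultimately show "(\<Sum>v\<in>?T. B (u, v)) = t * m1 u + (if u = x then 1 - t else 0)"
      unfolding B_def sum.distrib by (simp only: flip: sum_distrib_left)
  next
    fix v assume "v \<in> verts G"
    then have "(\<Sum>u\<in>?S. A (u, v)) = m2 v"
      using couplingD(6)[OF A] sum_column_eq[OF fin(1) subA] by metis
    moreover have "(\<Sum>u\<in>?S. if (u, v) = (x, y) then 1 - t else 0) = (if v = y then 1 - t else 0)"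
      using fin(1) by (cases "v = y") (simp_all only: prod.inject simp_thms sum.delta if_True if_False insertI1 sum.neutral_const)
    ultimately show "(\<Sum>u\<in>?S. B (u, v)) = t * m2 v + (if v = y then 1 - t else 0)"
      unfolding B_def sum.distrib by (simp only: flip: sum_distrib_left)
  qed
  let ?d = "\<lambda>p. ereal_of_enat (graph_dist G (fst p) (snd p))"
  have fin': "finite (?S \<times> ?T)" using fin by (rule finite_cartesian_product)
  have "transport_cost G B = (\<Sum>p\<in>?S \<times> ?T. ereal (B p) * ?d p)"
    unfolding transport_cost_eq[OF fin' subB] by (simp add: case_prod_unfold)
  also have "\<dots> = (\<Sum>p\<in>?S \<times> ?T. ereal t * (ereal (A p) * ?d p) + (if p = (x, y) then ereal (1 - t) * ?d p else 0))"
  proof (rule sum.cong[OF refl])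
    fix p
    have "ereal (B p) = ereal (t * A p) + ereal (if p = (x, y) then 1 - t else 0)"
      by (simp add: B_def)
    \<comment> \<open>The distance may be infinite, so distributivity in \<open>ereal\<close> relies
      on both summands being nonnegative.\<close>
    then have "ereal (B p) * ?d p = ereal (t * A p) * ?d p + ereal (if p = (x, y) then 1 - t else 0) * ?d p"
      using t nonneg[of p] by (simp only:) (rule ereal_left_distrib; simp)
    then show "ereal (B p) * ?d p = ereal t * (ereal (A p) * ?d p) + (if p = (x, y) then ereal (1 - t) * ?d p else 0)"
      by (simp add: mult.assoc[symmetric] flip: zero_ereal_def)
  qed
  also have "\<dots> = (\<Sum>p\<in>?S \<times> ?T. ereal t * (ereal (A p) * ?d p)) + ereal (1 - t) * ereal_of_enat (graph_dist G x y)"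
    unfolding sum.distrib sum.delta[OF fin'] by simp
  also have "(\<Sum>p\<in>?S \<times> ?T. ereal t * (ereal (A p) * ?d p)) = ereal t * (\<Sum>p\<in>?S \<times> ?T. ereal (A p) * ?d p)"
    by (rule sum_ereal_right_distrib[symmetric]) (simp add: nonneg ereal_0_le_mult)
  also have "(\<Sum>p\<in>?S \<times> ?T. ereal (A p) * ?d p) = transport_cost G A"
    unfolding transport_cost_eq[OF fin' subA] by (simp add: case_prod_unfold)
  finally show "transport_cost G B =
    ereal t * transport_cost G A + ereal (1 - t) * ereal_of_enat (graph_dist G x y)" .
qed

text \<open>Raising the laziness amounts to mixing in the point mass at the centre. The weight is
  forced by the mass \<open>1 - \<beta>\<close> that must remain on the neighbours.\<close>

lemma lazy_dist_mix:
  assumes "\<alpha> < 1"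
  shows "lazy_dist G \<beta> x =
    (\<lambda>v. (1 - \<beta>) / (1 - \<alpha>) * lazy_dist G \<alpha> x v + (if v = x then 1 - (1 - \<beta>) / (1 - \<alpha>) else 0))"
proof -
  define t where "t = (1 - \<beta>) / (1 - \<alpha>)"
  have "1 - \<beta> = t * (1 - \<alpha>)"
    using assms by (simp add: t_def)
  moreover from this have "\<beta> = t * \<alpha> + (1 - t)"
    by algebra
  ultimately show ?thesis
    unfolding lazy_dist_def t_def[symmetric] by (auto simp: fun_eq_iff)
qed

lemma wasserstein_lazy_mix:
  assumes G: "simple_graph G" "{x, y} \<in> edges G" and \<alpha>: "\<alpha> < 1" "\<alpha> \<le> \<beta>" "\<beta> < 1"
    and w: "wasserstein G (lazy_dist G \<alpha> x) (lazy_dist G \<alpha> y) = ereal w"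
  shows "wasserstein G (lazy_dist G \<beta> x) (lazy_dist G \<beta> y)
    \<le> ereal ((1 - \<beta>) / (1 - \<alpha>) * w + (1 - (1 - \<beta>) / (1 - \<alpha>)))"
\<comment> \<open>The infimum need not be known to be attained, so a plan within \<open>e\<close> of
  it is mixed with the point mass.\<close>
proof (rule ereal_le_epsilon2)
  fix e :: real assume "0 < e"
  define t where "t = (1 - \<beta>) / (1 - \<alpha>)"
  have t: "0 < t" "t \<le> 1"
    using \<alpha> by (simp_all add: t_def)
  have "wasserstein G (lazy_dist G \<alpha> x) (lazy_dist G \<alpha> y) < ereal (w + e)"
    using w \<open>0 < e\<close> by simp
  then obtain A where A: "coupling G (lazy_dist G \<alpha> x) (lazy_dist G \<alpha> y) A"
    and cost: "transport_cost G A < ereal (w + e)"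
    unfolding wasserstein_def Inf_less_iff by blast
  note mix = coupling_mix_point[OF A less_imp_le[OF t(1)] t(2) simple_graphD(2,3)[OF G]]
  from mix(1) have "wasserstein G (lazy_dist G \<beta> x) (lazy_dist G \<beta> y)
      \<le> ereal t * transport_cost G A + ereal (1 - t) * ereal_of_enat (graph_dist G x y)"
    unfolding mix(2)[symmetric] lazy_dist_mix[OF \<alpha>(1), of G \<beta>, folded t_def] by (rule wasserstein_le)
  also have "ereal_of_enat (graph_dist G x y) = 1"
    by (simp add: graph_dist_edge[OF G] one_enat_def)
  also have "ereal t * transport_cost G A \<le> ereal t * ereal (w + e)"
    using cost t by (intro ereal_mult_left_mono) auto
  also have "ereal t * ereal (w + e) + ereal (1 - t) * 1 = ereal (t * w + (1 - t)) + ereal (t * e)"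
    by (simp add: algebra_simps)
  also have "\<dots> \<le> ereal (t * w + (1 - t)) + ereal e"
    using t \<open>0 < e\<close> by simp
  finally show "wasserstein G (lazy_dist G \<beta> x) (lazy_dist G \<beta> y)
      \<le> ereal ((1 - \<beta>) / (1 - \<alpha>) * w + (1 - (1 - \<beta>) / (1 - \<alpha>))) + ereal e"
    unfolding t_def by (simp add: add_right_mono)
qed

lemma kappa_edge:
  "simple_graph G \<Longrightarrow> {x, y} \<in> edges G \<Longrightarrow>
    kappa G \<alpha> x y = 1 - wasserstein G (lazy_dist G \<alpha> x) (lazy_dist G \<alpha> y)"
  by (simp add: kappa_def graph_dist_edge one_enat_def divide_ereal_def)

text \<open>With \<open>t = (1 - \<beta>) / (1 - \<alpha>)\<close>, mixing gives
  \<open>1 - w' \<ge> t * (1 - w)\<close> for the two transport distances; dividing by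
  \<open>1 - \<beta> = t * (1 - \<alpha>)\<close> is the claim.\<close>

lemma kappa_quotient_mono:
  assumes G: "simple_graph G" "{x, y} \<in> edges G" and \<alpha>: "\<alpha> \<le> \<beta>" "\<beta> < 1"
  shows "kappa G \<alpha> x y / ereal (1 - \<alpha>) \<le> kappa G \<beta> x y / ereal (1 - \<beta>)"
proof (cases "wasserstein G (lazy_dist G \<alpha> x) (lazy_dist G \<alpha> y)")
  case (real w)
  define t where "t = (1 - \<beta>) / (1 - \<alpha>)"
  have t: "1 - \<beta> = t * (1 - \<alpha>)" "0 < t"
    using \<alpha> by (simp_all add: t_def)
  have "wasserstein G (lazy_dist G \<beta> x) (lazy_dist G \<beta> y) \<le> ereal (t * w + (1 - t))"
    unfolding t_def using G \<alpha> real by (intro wasserstein_lazy_mix) auto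
  then obtain w' where w': "wasserstein G (lazy_dist G \<beta> x) (lazy_dist G \<beta> y) = ereal w'"
    "w' \<le> t * w + (1 - t)"
    using wasserstein_nonneg[of G "lazy_dist G \<beta> x" "lazy_dist G \<beta> y"]
    by (cases "wasserstein G (lazy_dist G \<beta> x) (lazy_dist G \<beta> y)") auto
  have "(1 - w) / (1 - \<alpha>) = t * (1 - w) / (1 - \<beta>)"
    using t by simp
  also have "\<dots> \<le> (1 - w') / (1 - \<beta>)"
    using w'(2) \<alpha> by (intro divide_right_mono) (auto simp: algebra_simps)
  finally show ?thesis
    using \<alpha> by (simp add: kappa_edge[OF G] real w' one_ereal_def)
next
  \<comment> \<open>Here the left quotient is minus infinity.\<close>
  case PInf
  then show ?thesis
    using \<alpha> by (simp add: kappa_edge[OF G] divide_ereal_def one_ereal_def)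
next
  case MInf
  then show ?thesis
    using wasserstein_nonneg[of G "lazy_dist G \<alpha> x" "lazy_dist G \<alpha> y"] by simp
qed

text \<open>As the values are extended reals, monotonicity alone makes the limit exist.\<close>

lemma lly_curvature_eq_SUP:
  assumes G: "simple_graph G" "{x, y} \<in> edges G"
  shows "lly_curvature G x y = (SUP \<alpha>\<in>{0<..<1}. kappa G \<alpha> x y / ereal (1 - \<alpha>))"
    (is "_ = (SUP \<alpha>\<in>_. ?h \<alpha>)")
proof -
  have "(?h \<longlongrightarrow> (SUP \<alpha>\<in>{0<..<1}. ?h \<alpha>)) (at_left 1)"
  proof (rule increasing_tendsto)
    show "\<forall>\<^sub>F \<alpha> in at_left 1. ?h \<alpha> \<le> (SUP \<alpha>\<in>{0<..<1}. ?h \<alpha>)"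
      using eventually_at_left_real[of 0 1] by (rule eventually_mono) (auto intro: SUP_upper)
  next
    fix l assume "l < (SUP \<alpha>\<in>{0<..<1}. ?h \<alpha>)"
    then obtain \<alpha> where \<alpha>: "\<alpha> \<in> {0<..<1}" "l < ?h \<alpha>"
      unfolding less_SUP_iff by blast
    \<comment> \<open>By monotonicity the bound at the single point \<open>\<alpha>\<close> persists
      on the whole interval up to 1.\<close>
    show "\<forall>\<^sub>F \<beta> in at_left 1. l < ?h \<beta>"
      using eventually_at_left_real[of \<alpha> 1] 
    proof (rule eventually_mono)
      fix \<beta> assume "\<beta> \<in> {\<alpha><..<1}"
      then show "l < ?h \<beta>"
        using \<alpha> kappa_quotient_mono[OF G, of \<alpha> \<beta>] by (auto elim: less_le_trans)
    qed (use \<alpha> in simp)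
  qed
  then show ?thesis
    unfolding lly_curvature_def by (intro tendsto_Lim) simp
qed

text \<open>As the curvature is a supremum over the laziness, one convenient \<open>\<alpha>\<close>
  and one plan certify positivity; no limit has to be computed.\<close>

lemma lly_curvature_pos:
  assumes G: "simple_graph G" "{x, y} \<in> edges G" and \<alpha>: "0 < \<alpha>" "\<alpha> < 1"
    and A: "coupling G (lazy_dist G \<alpha> x) (lazy_dist G \<alpha> y) A" "transport_cost G A < 1"
  shows "0 < lly_curvature G x y"
proof -
  have "wasserstein G (lazy_dist G \<alpha> x) (lazy_dist G \<alpha> y) < 1"
    using A wasserstein_le by (meson le_less_trans)
  then have "0 < kappa G \<alpha> x y / ereal (1 - \<alpha>)"
    using \<alpha> wasserstein_nonneg[of G "lazy_dist G \<alpha> x" "lazy_dist G \<alpha> y"] unfolding kappa_edge[OF G]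
    by (cases "wasserstein G (lazy_dist G \<alpha> x) (lazy_dist G \<alpha> y)") (auto simp: one_ereal_def)
  also have "\<dots> \<le> lly_curvature G x y"
    unfolding lly_curvature_eq_SUP[OF G] using \<alpha> by (intro SUP_upper) auto
  finally show ?thesis .
qed

section \<open>Graphs without 4-cycles\<close>

lemma cycle_4_freeD:
  assumes "simple_graph G" "graph_free (cycle_graph 4) G"
    and "{a, b} \<in> edges G" "{b, c} \<in> edges G" "{c, d} \<in> edges G" "{d, a} \<in> edges G"
  shows "a = c \<or> b = d"
proof (rule ccontr)
  assume "\<not> (a = c \<or> b = d)"
  moreover have "a \<noteq> b" "b \<noteq> c" "c \<noteq> d" "d \<noteq> a"
    using simple_graphD(1)[OF assms(1)] assms(3-6) by blast+
  ultimately have "distinct [a, b, c, d]" by auto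
  then have "contains_copy G (cycle_graph 4)"
    unfolding contains_copy_cycle_4_iff[OF assms(1)] using assms(3-6) by blast
  then show False
    using assms(2) by (simp add: graph_free_def)
qed

text \<open>Two different common neighbours would close the 4-cycle \<open>x\<close>,
  \<open>z\<close>, \<open>y\<close>, \<open>z'\<close>.\<close>

lemma cycle_4_free_common_neighbor_unique:
  assumes "simple_graph G" "graph_free (cycle_graph 4) G" "x \<noteq> y"
    and "z \<in> neighborhood G x \<inter> neighborhood G y" "z' \<in> neighborhood G x \<inter> neighborhood G y"
  shows "z = z'"
  using cycle_4_freeD[OF assms(1,2), of x z y z'] assms(3-5)
  by (auto simp: neighborhood_iff insert_commute)

text \<open>The absence of 4-cycles makes the test function \<open>f\<close> 1-Lipschitz from the closed neighbourhood
  of \<open>x\<close> to that of \<open>y\<close>, which is all that couplings see.\<close>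

lemma lly_curvature_le:
  assumes G: "simple_graph G" "locally_finite G" "graph_free (cycle_graph 4) G"
    and e: "{x, y} \<in> edges G"
  defines "c \<equiv> card (neighborhood G x \<inter> neighborhood G y)"
  shows "lly_curvature G x y
    \<le> ereal (1 / real (degree G x) + (2 + 2 * real c) / real (degree G y) - 1)"
  unfolding lly_curvature_eq_SUP[OF G(1) e]
proof (rule SUP_least)
  fix \<alpha> :: real assume \<alpha>: "\<alpha> \<in> {0<..<1}"
  let ?N = "neighborhood G" and ?a = "real (degree G x)" and ?b = "real (degree G y)"
  define K where "K = 1 / ?a + (2 + 2 * real c) / ?b - 1"
  \<comment> \<open>The value 2 goes to the neighbours of \<open>y\<close> that have distance at
    least 2 from every vertex of the closed neighbourhood of \<open>x\<close> other than
    \<open>y\<close>; \<open>x\<close> and the common neighbours get 0.\<close>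
  define f :: "_ \<Rightarrow> real" where
    "f v = (if v = y then 1 else if v \<in> ?N y \<and> v \<notin> insert x (?N x) then 2 else 0)" for v
  have xy: "x \<noteq> y" "x \<in> verts G" "y \<in> verts G"
    using simple_graphD[OF G(1) e] by simp_all
  have fin: "finite (?N x)" "finite (?N y)"
    using G(2) xy by (auto simp: locally_finite_def)
  have N: "y \<in> ?N x" "x \<in> ?N y" "x \<notin> ?N x" "y \<notin> ?N y"
    using e not_self_neighbor[OF G(1)] by (auto simp: neighborhood_iff insert_commute)
  have sub: "insert x (?N x) \<subseteq> verts G" "insert y (?N y) \<subseteq> verts G"
    using xy simple_graphD(3)[OF G(1)] by (auto simp: neighborhood_iff)
  have "?b > 0"
    using N fin by (auto simp: degree_def card_gt_0_iff)
  have sum_y: "(\<Sum>v\<in>insert y (?N y). lazy_dist G \<alpha> y v * f v) = 1 + (1 - \<alpha>) * (1 - (2 + 2 * real c) / ?b)"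
  proof -
    \<comment> \<open>Among the neighbours of \<open>y\<close>, exactly \<open>x\<close> and the
      \<open>c\<close> common ones have value 0, which leaves \<open>?b - 1 - c\<close> neighbours
      with value 2.\<close>
    have "card (?N y \<inter> insert x (?N x)) = Suc c"
      using N fin unfolding c_def by (simp add: Int_commute)
    moreover have "card (?N y) = card (?N y \<inter> insert x (?N x)) + card (?N y - insert x (?N x))"
      using fin by (metis card_Int_Diff)
    ultimately have card: "real (card (?N y - insert x (?N x))) = ?b - 1 - real c"
      by (simp add: degree_def)
    have "(\<Sum>v\<in>?N y. lazy_dist G \<alpha> y v * f v)
        = (\<Sum>v\<in>?N y. if v \<in> ?N y - insert x (?N x) then (1 - \<alpha>) / ?b * 2 else 0)"
      using N by (intro sum.cong) (auto simp: lazy_dist_def f_def)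
    also have "\<dots> = (\<Sum>v\<in>?N y - insert x (?N x). (1 - \<alpha>) / ?b * 2)"
      using fin by (simp only: sum.inter_restrict[symmetric] Int_absorb1[OF Diff_subset])
    also have "\<dots> = (1 - \<alpha>) * ((2 * ?b - 2 - 2 * real c) / ?b)"
      unfolding sum_constant card by (simp add: algebra_simps)
    also have "(2 * ?b - 2 - 2 * real c) / ?b = 2 - (2 + 2 * real c) / ?b"
      using \<open>?b > 0\<close> by (simp add: diff_divide_distrib add_divide_distrib)
    finally have "(\<Sum>v\<in>?N y. lazy_dist G \<alpha> y v * f v) = (1 - \<alpha>) * (2 - (2 + 2 * real c) / ?b)" .
    then show ?thesis
      using N fin by (simp add: lazy_dist_def f_def algebra_simps)
  qed
  have sum_x: "(\<Sum>v\<in>insert x (?N x). lazy_dist G \<alpha> x v * f v) = (1 - \<alpha>) / ?a"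
  proof -
    \<comment> \<open>On the closed neighbourhood of \<open>x\<close> the function \<open>f\<close>
      vanishes except at \<open>y\<close>.\<close>
    have "(\<Sum>v\<in>?N x. lazy_dist G \<alpha> x v * f v) = (\<Sum>v\<in>?N x. if v = y then (1 - \<alpha>) / ?a else 0)"
      using N by (intro sum.cong) (auto simp: lazy_dist_def f_def)
    also have "\<dots> = (1 - \<alpha>) / ?a"
      using N fin by simp
    finally show ?thesis
      using N fin xy by (simp add: f_def)
  qed
  have lip: "ereal (f v - f u) \<le> ereal_of_enat (graph_dist G u v)"
    if u: "u \<in> insert x (?N x)" and v: "v \<in> insert y (?N y)" for u v
  proof -
    have "f u \<in> {0, 1, 2}" "f v \<in> {0, 1, 2}"
      by (simp_all add: f_def)
    then consider "f v - f u \<le> 0" | "f v - f u \<le> 1" "u \<noteq> v" | "f v = 2" "f u = 0"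
      by (cases "u = v") auto
    then show ?thesis
    proof cases
      case 1
      then have "ereal (f v - f u) \<le> 0" by simp
      then show ?thesis
        using ereal_of_enat_nonneg order_trans by blast
    next
      case 2
      have "ereal (f v - f u) \<le> ereal_of_enat 1"
        using 2(1) by (simp add: one_enat_def)
      also have "\<dots> \<le> ereal_of_enat (graph_dist G u v)"
        unfolding ereal_of_enat_le_iff by (rule graph_dist_ge_1[OF 2(2)])
      finally show ?thesis .
    next
      case 3
      then have v': "v \<in> ?N y" "v \<notin> insert x (?N x)" and "u \<noteq> y" "u \<noteq> v"
        by (auto simp: f_def split: if_splits)
      \<comment> \<open>Since \<open>v\<close> is not adjacent to \<open>x\<close>, such an edge
        would have \<open>u \<noteq> x\<close> and close the 4-cycle \<open>x\<close>,
        \<open>u\<close>, \<open>v\<close>, \<open>y\<close>.\<close>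
      have "{u, v} \<notin> edges G"
      proof
        assume "{u, v} \<in> edges G"
        moreover from this have "u \<noteq> x" using v' by (auto simp: neighborhood_iff)
        ultimately show False
          using cycle_4_freeD[OF G(1,3), of x u v y] u v' \<open>u \<noteq> y\<close> e
          by (auto simp: neighborhood_iff insert_commute)
      qed
      from graph_dist_ge_2[OF \<open>u \<noteq> v\<close> this]
      have "ereal_of_enat 2 \<le> ereal_of_enat (graph_dist G u v)"
        unfolding ereal_of_enat_le_iff .
      then show ?thesis using 3 by (simp add: numeral_eq_enat)
    qed
  qed
  have "ereal (1 - (1 - \<alpha>) * K) \<le> wasserstein G (lazy_dist G \<alpha> x) (lazy_dist G \<alpha> y)"
    unfolding wasserstein_def
  proof (rule Inf_greatest, clarify)
    fix A assume "coupling G (lazy_dist G \<alpha> x) (lazy_dist G \<alpha> y) A"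
    then have "ereal ((\<Sum>v\<in>insert y (?N y). lazy_dist G \<alpha> y v * f v)
        - (\<Sum>v\<in>insert x (?N x). lazy_dist G \<alpha> x v * f v)) \<le> transport_cost G A"
      by (rule transport_cost_ge[OF _ _ sub(1) _ _ sub(2) _ lip])
        (use fin in \<open>auto simp: lazy_dist_def split: if_splits\<close>)
    also have "(\<Sum>v\<in>insert y (?N y). lazy_dist G \<alpha> y v * f v)
        - (\<Sum>v\<in>insert x (?N x). lazy_dist G \<alpha> x v * f v) = 1 - (1 - \<alpha>) * K"
      unfolding sum_x sum_y K_def by (simp add: algebra_simps)
    finally show "ereal (1 - (1 - \<alpha>) * K) \<le> transport_cost G A" .
  qed
  then have "kappa G \<alpha> x y \<le> 1 - ereal (1 - (1 - \<alpha>) * K)"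
    unfolding kappa_edge[OF G(1) e] by (intro ereal_minus_mono order_refl)
  then have "kappa G \<alpha> x y \<le> ereal (1 - \<alpha>) * ereal K"
    by (simp add: one_ereal_def)
  then have "kappa G \<alpha> x y / ereal (1 - \<alpha>) \<le> ereal K"
    using \<alpha> by (simp add: ereal_divide_le_pos)
  then show "kappa G \<alpha> x y / ereal (1 - \<alpha>)
      \<le> ereal (1 / ?a + (2 + 2 * real c) / ?b - 1)"
    unfolding K_def .
qed

section \<open>Parity of a matching and the bound on the degree\<close>

lemma even_card_involution:
  assumes "finite X" and h: "\<And>x. x \<in> X \<Longrightarrow> h x \<in> X" "\<And>x. x \<in> X \<Longrightarrow> h (h x) = x"
    "\<And>x. x \<in> X \<Longrightarrow> h x \<noteq> x"
  shows "even (card X)"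
proof -
  \<comment> \<open>The orbits \<open>{x, h x}\<close> have two elements each and partition
    \<open>X\<close>.\<close>
  let ?C = "(\<lambda>x. {x, h x}) ` X"
  have "\<Union>?C = X" using h(1) by auto
  moreover have "2 dvd card (\<Union>?C)"
  proof (rule dvd_partition)
    show "finite (\<Union>?C)" using assms(1) by simp
    show "\<forall>c\<in>?C. 2 dvd card c"
    proof
      fix c assume "c \<in> ?C"
      then obtain x where "x \<in> X" "c = {x, h x}" by blast
      with h(3)[of x] have "card c = 2" by (metis card_2_iff)
      then show "2 dvd card c" by simp
    qed
    show "\<forall>c1\<in>?C. \<forall>c2\<in>?C. c1 \<noteq> c2 \<longrightarrow> c1 \<inter> c2 = {}"
    proof (intro ballI impI)
      fix c1 c2 assume "c1 \<in> ?C" "c2 \<in> ?C" and ne: "c1 \<noteq> c2"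
      then obtain x y where xy: "x \<in> X" "y \<in> X" and c: "c1 = {x, h x}" "c2 = {y, h y}"
        by blast
      have "c1 = c2" if "z \<in> c1" "z \<in> c2" for z
        using that h(2)[OF xy(1)] h(2)[OF xy(2)] unfolding c
        by (metis insert_commute insert_iff singletonD)
      then show "c1 \<inter> c2 = {}" using ne by blast
    qed
  qed
  ultimately show ?thesis by simp
qed

lemma degree_le_6:
  assumes G: "simple_graph G" "locally_finite G" "graph_free (cycle_graph 4) G"
    and pos: "positively_lly_curved G"
    and deg: "\<And>v. v \<in> verts G \<Longrightarrow> 2 \<le> degree G v"
    and y: "y \<in> verts G"
  shows "degree G y \<le> 6"
proof (rule ccontr)
  assume "\<not> degree G y \<le> 6"
  then have b: "7 \<le> degree G y" by simp
  let ?N = "neighborhood G"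
  have fin: "finite (?N v)" if "v \<in> verts G" for v
    using G(2) that by (simp add: locally_finite_def)
  have *: "degree G y = 7 \<and> (\<exists>z. z \<in> ?N x \<inter> ?N y)" if x: "x \<in> ?N y" for x
  proof -
    define c where "c = card (?N x \<inter> ?N y)"
    have e: "{x, y} \<in> edges G" using x by (simp add: neighborhood_def)
    note xy = simple_graphD[OF G(1) e]
    have "finite (?N x \<inter> ?N y)" using fin[OF y] by simp
    then have "c \<le> 1"
      unfolding c_def One_nat_def
      using cycle_4_free_common_neighbor_unique[OF G(1,3) xy(1)] card_le_Suc0_iff_eq by blast
    have "0 < lly_curvature G x y"
      using pos e by (simp add: positively_lly_curved_def)
    also have "\<dots> \<le> ereal (1 / real (degree G x) + (2 + 2 * real c) / real (degree G y) - 1)"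
      unfolding c_def by (rule lly_curvature_le[OF G e])
    finally have "1 < 1 / real (degree G x) + (2 + 2 * real c) / real (degree G y)"
      by simp
    moreover have "1 / real (degree G x) \<le> 1 / 2"
      using deg[OF xy(2)] by (intro divide_left_mono) auto
    ultimately have "1 / 2 < (2 + 2 * real c) / real (degree G y)" by linarith
    \<comment> \<open>With \<open>c = 0\<close> this would give a degree below 4, against
      \<open>b\<close>; so \<open>c = 1\<close>, and the degree is below 8.\<close>
    then have "real (degree G y) < 4 + 4 * real c"
      using b by (simp add: field_simps)
    with b \<open>c \<le> 1\<close> have "degree G y = 7" "c \<noteq> 0" by linarith+
    then show ?thesis
      unfolding c_def by (metis card.empty equals0I)
  qed
  \<comment> \<open>\<open>h x\<close> is the third vertex of the triangle on the edge
    \<open>xy\<close>.\<close>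
  then obtain h where h: "h x \<in> ?N x \<inter> ?N y" if "x \<in> ?N y" for x by metis
  have "even (degree G y)"
    unfolding degree_def
  proof (rule even_card_involution[of _ h])
    show "finite (?N y)" by (rule fin[OF y])
  next
    fix x assume x: "x \<in> ?N y"
    show hx: "h x \<in> ?N y" using h[OF x] by simp
    show "h x \<noteq> x"
      using h[OF x] not_self_neighbor[OF G(1)] by auto
    have "h x \<noteq> y"
      using hx not_self_neighbor[OF G(1)] by auto
    \<comment> \<open>Now \<open>x\<close> and \<open>h (h x)\<close> are both common neighbours of
      \<open>h x\<close> and \<open>y\<close>, so they coincide.\<close>
    moreover have "x \<in> ?N (h x) \<inter> ?N y"
      using h[OF x] x by (simp add: neighborhood_iff insert_commute)
    ultimately show "h (h x) = x"
      using cycle_4_free_common_neighbor_unique[OF G(1,3)] h[OF hx] by blast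
  qed
  moreover have "degree G y = 7"
  proof -
    have "?N y \<noteq> {}" using b by (auto simp: degree_def)
    then show ?thesis using * by blast
  qed
  ultimately show False by simp
qed

section \<open>Three triangles sharing a vertex\<close>

text \<open>This is the friendship graph with hub 0. The value \<open>(u + 1) div 2\<close> numbers
  the triangles, whose outer pairs are 1, 2 and 3, 4 and 5, 6.\<close>

definition windmill :: "nat ugraph" where
  "windmill = \<lparr>verts = {..<7}, edges = {{u, v} | u v. u < 7 \<and> v < 7 \<and> u \<noteq> v \<and>
     (u = 0 \<or> v = 0 \<or> (u + 1) div 2 = (v + 1) div 2)}\<rparr>"

lemma verts_windmill: "verts windmill = {..<7}"
  by (simp add: windmill_def)

lemma edges_windmill_iff:
  "{u, v} \<in> edges windmill \<longleftrightarrow> u < 7 \<and> v < 7 \<and> u \<noteq> v \<and>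
     (u = 0 \<or> v = 0 \<or> (u + 1) div 2 = (v + 1) div 2)"
  unfolding windmill_def by (auto simp: doubleton_eq_iff)

lemma simple_graph_windmill: "simple_graph windmill"
  unfolding simple_graph_def windmill_def by auto

lemma cycle_4_free_windmill: "graph_free (cycle_graph 4) windmill"
proof -
  \<comment> \<open>A class of \<open>(u + 1) div 2\<close> has at most two members. A 4-cycle meets
    the hub at most once, so it would contain three consecutive vertices of one class.\<close>
  have tri: "u = v \<or> v = w \<or> u = w"
    if "(u + 1) div 2 = (v + 1) div 2" "(v + 1) div 2 = (w + 1) div 2" for u v w :: nat
    using that by arith
  show ?thesis
    unfolding graph_free_def contains_copy_cycle_4_iff[OF simple_graph_windmill] edges_windmill_iff
  proof (safe, goal_cases)
    case (1 a b c d)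
    then show False
      using tri[of a b c] tri[of b c d] tri[of c d a] tri[of d a b] by auto
  qed (auto dest: tri)
qed

text \<open>The outer pair of triangle \<open>k\<close> is \<open>2 * k - 1\<close>,
  \<open>2 * k\<close>, with sum \<open>4 * k - 1\<close>; subtracting \<open>i\<close> yields its
  partner.\<close>

lemma neighborhood_windmill:
  "neighborhood windmill 0 = {1..<7}"
  "i \<in> {1..<7} \<Longrightarrow> neighborhood windmill i = {0, 4 * ((i + 1) div 2) - 1 - i}"
proof -
  show "neighborhood windmill 0 = {1..<7}"
    by (auto simp: neighborhood_def edges_windmill_iff)
  assume i: "i \<in> {1..<7}"
  show "neighborhood windmill i = {0, 4 * ((i + 1) div 2) - 1 - i}"
  proof (intro set_eqI)
    fix u
    have "i = 1 \<or> i = 2 \<or> i = 3 \<or> i = 4 \<or> i = 5 \<or> i = 6" using i by auto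
    then show "u \<in> neighborhood windmill i \<longleftrightarrow> u \<in> {0, 4 * ((i + 1) div 2) - 1 - i}"
      unfolding neighborhood_def mem_Collect_eq edges_windmill_iff insert_iff empty_iff
      by (elim disjE) (simp_all, presburger+)
  qed
qed

lemma degree_windmill:
  "degree windmill 0 = 6"
  "i \<in> {1..<7} \<Longrightarrow> degree windmill i = 2"
proof -
  show "degree windmill 0 = 6"
    by (simp add: degree_def neighborhood_windmill)
  assume i: "i \<in> {1..<7}"
  then have "4 * ((i + 1) div 2) - 1 - i \<noteq> 0"
    unfolding atLeastLessThan_iff by arith
  then show "degree windmill i = 2"
    unfolding degree_def neighborhood_windmill(2)[OF i] by simp
qed

text \<open>Routing through the hub bounds every distance by 1 or 2. This overestimates only the two
  outer vertices of one triangle, and it spares computing exact distances.\<close>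

lemma windmill_cost_less_1:
  assumes A: "coupling windmill m1 m2 A"
    and cost: "(\<Sum>u<7. \<Sum>v<7. A (u, v) * (if u = v then 0 else if u = 0 \<or> v = 0 then 1 else 2)) < 1"
  shows "transport_cost windmill A < 1"
proof -
  let ?D = "\<lambda>u v :: nat. if u = v then 0 else if u = 0 \<or> v = 0 then 1 else 2 :: enat"
  let ?d = "\<lambda>u v :: nat. if u = v then 0 else if u = 0 \<or> v = 0 then 1 else 2 :: real"
  have D: "graph_dist windmill u v \<le> ?D u v" if "u < 7" "v < 7" for u v
    using that graph_dist_refl[of u windmill] graph_dist_edge_le[OF simple_graph_windmill, of u v]
      graph_dist_common_neighbor_le[OF simple_graph_windmill, of u 0 v]
    by (auto simp: verts_windmill edges_windmill_iff)
  have "transport_cost windmill A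
      = (\<Sum>(u, v)\<in>{..<7} \<times> {..<7}. ereal (A (u, v)) * ereal_of_enat (graph_dist windmill u v))"
    using couplingD(2)[OF A] by (intro transport_cost_eq) (auto simp: verts_windmill)
  also have "\<dots> \<le> (\<Sum>(u, v)\<in>{..<7} \<times> {..<7}. ereal (A (u, v)) * ereal_of_enat (?D u v))"
    using couplingD(3)[OF A] D
    by (intro sum_mono) (auto simp del: ereal_of_enat_simps intro!: ereal_mult_left_mono)
  also have "\<dots> = (\<Sum>(u, v)\<in>{..<7} \<times> {..<7}. ereal (A (u, v) * ?d u v))"
    by (intro sum.cong) (auto simp: one_enat_def numeral_eq_enat)
  also have "\<dots> = ereal (\<Sum>u<7. \<Sum>v<7. A (u, v) * ?d u v)"
    by (simp add: sum.cartesian_product case_prod_unfold)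
  also have "\<dots> < 1" using cost by simp
  finally show ?thesis .
qed

text \<open>Everything is reduced to finite sums over seven vertices. The weights are symmetric, so
  the swapped plan serves the reversed edge at the same cost.\<close>

lemma lly_curvature_windmill_pos:
  assumes e: "{x, y} \<in> edges windmill" and \<alpha>: "0 < \<alpha>" "\<alpha> < 1"
    and A: "\<And>p. 0 \<le> A p" "\<And>p. A p \<le> 1" "\<And>u v. A (u, v) \<noteq> 0 \<Longrightarrow> u < 7 \<and> v < 7"
    and rows: "\<And>u. u < 7 \<Longrightarrow> (\<Sum>v<7. A (u, v)) = lazy_dist windmill \<alpha> x u"
    and columns: "\<And>v. v < 7 \<Longrightarrow> (\<Sum>u<7. A (u, v)) = lazy_dist windmill \<alpha> y v"
    and cost: "(\<Sum>u<7. \<Sum>v<7. A (u, v) * (if u = v then 0 else if u = 0 \<or> v = 0 then 1 else 2)) < 1"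
  shows "0 < lly_curvature windmill x y" "0 < lly_curvature windmill y x"
proof -
  have coupl: "coupling windmill (lazy_dist windmill \<alpha> x) (lazy_dist windmill \<alpha> y) A"
    by (rule couplingI[of "{..<7}" "{..<7}"])
      (use A rows columns in \<open>auto simp: verts_windmill\<close>)
  show "0 < lly_curvature windmill x y"
    using lly_curvature_pos[OF simple_graph_windmill e \<alpha> coupl windmill_cost_less_1[OF coupl cost]] .
  note coupl' = coupling_swap[OF coupl]
  have "(\<Sum>u<7. \<Sum>v<7. (A \<circ> prod.swap) (u, v) * (if u = v then 0 else if u = 0 \<or> v = 0 then 1 else 2))
      = (\<Sum>u<7. \<Sum>v<7. A (u, v) * (if u = v then 0 else if u = 0 \<or> v = 0 then 1 else 2))"
    by (subst sum.swap) (intro sum.cong refl, auto)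
  then have "(\<Sum>u<7. \<Sum>v<7. (A \<circ> prod.swap) (u, v) * (if u = v then 0 else if u = 0 \<or> v = 0 then 1 else 2)) < 1"
    using cost by simp
  from lly_curvature_pos[OF simple_graph_windmill _ \<alpha> coupl' windmill_cost_less_1[OF coupl' this]] e
  show "0 < lly_curvature windmill y x"
    by (simp add: insert_commute)
qed

text \<open>For \<open>\<alpha> = 1/7\<close> the mass at the hub 0 is uniform on the whole graph, so that only the mass
  of the four vertices outside the triangle of \<open>i\<close> has to move, to the other two vertices of that
  triangle.\<close>

lemma lly_curvature_windmill_hub:
  assumes i: "i \<in> {1..<7}"
  shows "0 < lly_curvature windmill 0 i" "0 < lly_curvature windmill i 0"
proof -
  \<comment> \<open>The target has mass 1/7 at \<open>i\<close> and 3/7 at both the hub and the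
    partner of \<open>i\<close>. Each of the four outside vertices therefore splits its 1/7 evenly
    between these two.\<close>
  define A :: "nat \<times> nat \<Rightarrow> real" where "A = (\<lambda>(u, v).
    if u \<in> {0, i, 4 * ((i + 1) div 2) - 1 - i} then if u = v then 1 / 7 else 0
    else if u < 7 \<and> v \<in> {0, 4 * ((i + 1) div 2) - 1 - i} then 1 / 14 else 0)"
  have 7: "{..<7} = {0, 1, 2, 3, 4, 5, 6 :: nat}" by auto
  have i': "i = 1 \<or> i = 2 \<or> i = 3 \<or> i = 4 \<or> i = 5 \<or> i = 6" using i by auto
  have e: "{0, i} \<in> edges windmill" using i by (simp add: edges_windmill_iff)
  note simps = 7 A_def lazy_dist_def degree_windmill neighborhood_windmill
  have bounds: "0 \<le> A p" "A p \<le> 1" for p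
    by (auto simp: A_def split: prod.splits)
  have support: "u < 7 \<and> v < 7" if "A (u, v) \<noteq> 0" for u v
    using that i' by (auto simp: A_def split: if_splits)
  have rows: "(\<Sum>v<7. A (u, v)) = lazy_dist windmill (1 / 7) 0 u" if "u < 7" for u
  proof -
    have "u \<in> {0, 1, 2, 3, 4, 5, 6}" using that 7 by blast
    then show ?thesis using i' unfolding simps(1) by (elim disjE insertE emptyE) (simp_all add: simps)
  qed
  have columns: "(\<Sum>u<7. A (u, v)) = lazy_dist windmill (1 / 7) i v" if "v < 7" for v
  proof -
    have "v \<in> {0, 1, 2, 3, 4, 5, 6}" using that 7 by blast
    then show ?thesis using i' unfolding simps(1) by (elim disjE insertE emptyE) (simp_all add: simps)
  qed
  \<comment> \<open>The cost is four times \<open>1/14 * 1 + 1/14 * 2\<close>, that is 6/7.\<close>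
  have cost: "(\<Sum>u<7. \<Sum>v<7. A (u, v) * (if u = v then 0 else if u = 0 \<or> v = 0 then 1 else 2)) < 1"
    using i' unfolding simps(1) by (elim disjE) (simp_all add: simps)
  show "0 < lly_curvature windmill 0 i" "0 < lly_curvature windmill i 0"
    by (rule lly_curvature_windmill_pos[OF e _ _ bounds support rows columns cost]; simp)+
qed

text \<open>For \<open>\<alpha> = 1/3\<close> the two distributions are both uniform on the triangle.\<close>

lemma lly_curvature_windmill_rim:
  assumes e: "{i, j} \<in> edges windmill" and ij: "i \<noteq> 0" "j \<noteq> 0"
  shows "0 < lly_curvature windmill i j"
proof -
  \<comment> \<open>The diagonal plan leaves all mass in place and costs nothing.\<close>
  define A :: "nat \<times> nat \<Rightarrow> real" where
    "A = (\<lambda>(u, v). if u = v then if u \<in> {0, i, j} then 1 / 3 else 0 else 0)"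
  have *: "i < 7" "j < 7" "i \<noteq> j"
    using e by (auto simp: edges_windmill_iff)
  have nbh: "neighborhood windmill u = {0, v}" "degree windmill u = 2"
    if "{u, v} \<in> edges windmill" "u \<noteq> 0" "v \<noteq> 0" for u v
  proof -
    have u: "u \<in> {1..<7}"
      using that by (simp add: edges_windmill_iff)
    then show "degree windmill u = 2" by (rule degree_windmill(2))
    obtain w where w: "neighborhood windmill u = {0, w}"
      using neighborhood_windmill(2)[OF u] by blast
    have "v \<in> neighborhood windmill u"
      using that(1) by (simp add: neighborhood_iff)
    then have "v = w" using w that(3) by simp
    then show "neighborhood windmill u = {0, v}" using w by simp
  qed
  have e': "{j, i} \<in> edges windmill"
    using e by (simp add: insert_commute)
  note N = nbh(1)[OF e ij] nbh(1)[OF e' ij(2,1)] and deg = nbh(2)[OF e ij] nbh(2)[OF e' ij(2,1)]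
  show ?thesis
  proof (rule lly_curvature_windmill_pos(1)[OF e, of "1 / 3" A])
    show "(\<Sum>v<7. A (u, v)) = lazy_dist windmill (1 / 3) i u" if "u < 7" for u
      using that ij * by (simp add: A_def lazy_dist_def N deg)
    show "(\<Sum>u<7. A (u, v)) = lazy_dist windmill (1 / 3) j v" if "v < 7" for v
      using that ij * by (simp add: A_def lazy_dist_def N deg)
    have "(\<Sum>u<7. \<Sum>v<7. A (u, v) * (if u = v then 0 else if u = 0 \<or> v = 0 then 1 else 2)) = 0"
      by (intro sum.neutral ballI) (simp add: A_def)
    then show "(\<Sum>u<7. \<Sum>v<7. A (u, v) * (if u = v then 0 else if u = 0 \<or> v = 0 then 1 else 2)) < 1"
      by simp
  qed (use * in \<open>auto simp: A_def split: if_splits prod.splits\<close>)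
qed

lemma positively_lly_curved_windmill: "positively_lly_curved windmill"
  unfolding positively_lly_curved_def
proof (intro allI impI)
  fix x y assume e: "{x, y} \<in> edges windmill"
  then consider "x = 0" "y \<in> {1..<7}" | "y = 0" "x \<in> {1..<7}" | "x \<noteq> 0" "y \<noteq> 0"
    by (auto simp: edges_windmill_iff)
  then show "0 < lly_curvature windmill x y"
    using lly_curvature_windmill_hub lly_curvature_windmill_rim[OF e] by cases auto
qed

theorem theorem1p4:
  "(\<forall>G :: 'a ugraph.
      simple_graph G \<and> locally_finite G \<and> positively_lly_curved G \<and>
      graph_free (cycle_graph 4) G \<and> min_degree G \<ge> 2
      \<longrightarrow> max_degree G \<le> 6) \<and>
   (\<exists>G :: nat ugraph.
      simple_graph G \<and> locally_finite G \<and> positively_lly_curved G \<and>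
      graph_free (cycle_graph 4) G \<and> min_degree G \<ge> 2 \<and> max_degree G = 6)"
proof (intro conjI allI impI)
  fix G :: "'a ugraph"
  assume G: "simple_graph G \<and> locally_finite G \<and> positively_lly_curved G \<and>
    graph_free (cycle_graph 4) G \<and> min_degree G \<ge> 2"
  have "2 \<le> degree G v" if "v \<in> verts G" for v
  proof -
    have "2 \<le> enat (degree G v)"
      using G that unfolding min_degree_def by (auto simp: le_INF_iff)
    then show ?thesis by (simp add: numeral_eq_enat)
  qed
  then have "degree G v \<le> 6" if "v \<in> verts G" for v
    using degree_le_6[of G v] G that by blast
  then show "max_degree G \<le> 6"
    unfolding max_degree_def by (intro SUP_least) (simp add: numeral_eq_enat)
next
  have deg: "degree windmill v \<in> {2, 6}" if "v \<in> verts windmill" for v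
    using that degree_windmill(1) degree_windmill(2)[of v] by (cases "v = 0") (auto simp: verts_windmill)
  have "locally_finite windmill"
    unfolding locally_finite_def
  proof
    fix v assume "v \<in> verts windmill"
    then show "finite (neighborhood windmill v)"
      using neighborhood_windmill(1) neighborhood_windmill(2)[of v]
      by (cases "v = 0") (auto simp: verts_windmill)
  qed
  moreover have "min_degree windmill \<ge> 2"
    unfolding min_degree_def using deg by (intro INF_greatest) (fastforce simp: numeral_eq_enat)
  moreover have "max_degree windmill = 6"
    unfolding max_degree_def
  proof (rule antisym)
    show "(SUP v\<in>verts windmill. enat (degree windmill v)) \<le> 6"
      using deg by (intro SUP_least) (fastforce simp: numeral_eq_enat)
    show "6 \<le> (SUP v\<in>verts windmill. enat (degree windmill v))"
      using degree_windmill(1)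
      by (intro SUP_upper2[of 0]) (simp_all add: verts_windmill numeral_eq_enat)
  qed
  ultimately show "\<exists>G :: nat ugraph.
      simple_graph G \<and> locally_finite G \<and> positively_lly_curved G \<and>
      graph_free (cycle_graph 4) G \<and> min_degree G \<ge> 2 \<and> max_degree G = 6"
    using simple_graph_windmill positively_lly_curved_windmill cycle_4_free_windmill by blast
qed

end
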